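(* Let $\mathscr F$ be a Hilbert space, $T\in(0,\infty)$, and let $\mathfrak f=\{\mathscr F_s\}_{s\in[0,T]}$ be a continuous bordered nest of closed subspaces of $\mathscr F$. Let $C$ and $C^\alpha$ ($\alpha>0$) be bounded positive operators in $\mathscr F$ such that: 1. $C^\alpha\to C$ in the strong operator topology as $\alpha\to\infty$; 2. $C$ and every $C^\alpha$ admit the canonical triangular factorization with respect to $\mathfrak f$, i.e. the diagonals $D_{\sqrt C}$ and $D_{\sqrt{C^\alpha}}$ exist, $D_{\sqrt C}D_{\sqrt C}^*=\mathbb I$, $D_{\sqrt{C^\alpha}}D_{\sqrt{C^\alpha}}^*=\mathbb I$, and $C=V^*V$, $C^\alpha=V^{\alpha\,*}V^\alpha$ with $V=D_{\sqrt C}^*\sqrt C$, $V^\alpha=D_{\sqrt{C^\alpha}}^*\sqrt{C^\alpha}$; 3. $\sqrt{C^\alpha}$ converges to $\sqrt C$ regularly on the nest $\mathfrak f$ as $\alpha\to\infty$; 4. the integral sums defining $D_{\sqrt C}$ and $D_{\sqrt{C^\alpha}}$ converge to their weak limits uniformly with respect to $\alpha$: for every $\varepsilon>0$ and all $f,h\in\mathscr F$ there is $\delta>0$, independent of $\alpha$, such that for every partition $\Xi$ of $[0,T]$ of range less than $\delta$ and every $\alpha$ one has $$\big|\big([D_{\sqrt C}-D^\Xi_{\sqrt C}]f,h\big)\big|<\varepsilon\quad\text{and}\quad \big|\big([D_{\sqrt{C^\alpha}}-D^\Xi_{\sqrt{C^\alpha}}]f,h\big)\big|<\varepsilon .$$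 Then $V^\alpha\to V$ in the weak operator topology as $\alpha\to\infty$.
   Context: All operators are bounded and linear. An operator $C$ in $\mathscr F$ is called positive if it is self-adjoint and $(Cf,f)>0$ for all $f\neq0$ (it need not be positive definite, i.e. need not be bounded below by a positive constant); $\sqrt C$ denotes its positive square root. Nest: $\mathfrak f=\{\mathscr F_s\}_{s\in[0,T]}$ is a family of closed subspaces of $\mathscr F$; $X_s$ denotes the orthogonal projection in $\mathscr F$ onto $\mathscr F_s$. Continuous and bordered means: $\mathscr F_s\subset\mathscr F_{s'}$ for $0\leqslant s<s'\leqslant T$; $X_{s'}\to X_s$ strongly as $s'\to s$; $\mathscr F_0=\{0\}$ and $\mathscr F_T=\mathscr F$. Diagonal: let $W$ be an operator in $\mathscr F$ and let $P_s$ be the orthogonal projection in $\mathscr F$ onto $\overline{W\mathscr F_s}$. For a partition $\Xi:\ 0=s_0<s_1<\dots<s_n=T$ of $[0,T]$, its range is $r^\Xi=\max_{1\leqslant k\leqslant n}(s_k-s_{k-1})$, and $$D_W^\Xi:=\sum_{k=1}^n (P_{s_k}-P_{s_{k-1}})\,W\,(X_{s_k}-X_{s_{k-1}}).$$ The diagonal of $W$ with respect to $\mathfrak f$ is the operator $D_W$ (if it exists) which is the weak limit of $D_W^\Xi$ as $r^\Xi\to0$ in the Riemann sense: for every $\varepsilon>0$ and all $f,h\in\mathscr F$ there is $\delta>0$ such that $|([D_W-D_W^\Xi]f,h)|<\varepsilon$ for every partition $\Xi$ with $r^\Xi<\delta$. For $W=\sqrt C$ (respectively $W=\sqrt{C^\alpha}$)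 the projections involved are those onto $\overline{\sqrt C\,\mathscr F_s}$ (respectively $\overline{\sqrt{C^\alpha}\,\mathscr F_s}$). Canonical triangular factorization: a positive operator $C$ admits the canonical triangular factorization with respect to $\mathfrak f$ if the diagonal $D_{\sqrt C}$ exists, satisfies $D_{\sqrt C}D_{\sqrt C}^*=\mathbb I$, and $C=V^*V$ with $V=D_{\sqrt C}^*\sqrt C$ (such a $V$ satisfies $V\mathscr F_s\subset\mathscr F_s$ for all $s$). Regular convergence: operators $W^\alpha$ converge to $W$ regularly on the nest $\mathfrak f$ as $\alpha\to\infty$ if $W^\alpha\to W$ strongly and, for all $s\in[0,T]$, $P_s^\alpha\to P_s$ strongly, where $P_s^\alpha$ and $P_s$ are the orthogonal projections onto $\overline{W^\alpha\mathscr F_s}$ and $\overline{W\mathscr F_s}$ respectively. *)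

theory Defs
  imports "HOL-Analysis.Analysis"
begin

text \<open>
  A real normed field is (up to isomorphism) the field of real or of complex numbers, and the
  last axiom then forces \<open>conjugate\<close> to be the usual conjugation. Quantifying over this class
  therefore treats real and complex Hilbert spaces simultaneously.
\<close>

class rc_field = real_normed_field +
  fixes conjugate :: "'a \<Rightarrow> 'a"
  assumes conjugate_add: "conjugate (a + b) = conjugate a + conjugate b"
    and conjugate_mult: "conjugate (a * b) = conjugate a * conjugate b"
    and mult_conjugate: "a * conjugate a = (norm a)\<^sup>2 *\<^sub>R 1"

instantiation real :: rc_field
begin
definition conjugate_real :: "real \<Rightarrow> real" where "conjugate_real a = a"
instance by standard (auto simp: conjugate_real_def power2_eq_square)
end

instantiation complex :: rc_field
begin
definition conjugate_complex :: "complex \<Rightarrow> complex" where "conjugate_complex = cnj"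
instance by standard
    (auto simp: conjugate_complex_def complex_norm_square scaleR_conv_of_real simp del: of_real_power)
end

text \<open>The inner product is linear in its first argument and induces the norm of the Banach space.\<close>

locale hilbert_space = vector_space smul
  for smul :: "'k::rc_field \<Rightarrow> 'f::banach \<Rightarrow> 'f" +
  fixes ip :: "'f \<Rightarrow> 'f \<Rightarrow> 'k"
  assumes scale_of_real: "smul (of_real r) f = r *\<^sub>R f"
    and ip_add: "ip (f + g) h = ip f h + ip g h"
    and ip_scale: "ip (smul c f) h = c * ip f h"
    and ip_conjugate: "ip h f = conjugate (ip f h)"
    and ip_self: "ip f f = of_real ((norm f)\<^sup>2)"

lemma hilbert_space_real:
  "hilbert_space (scaleR :: real \<Rightarrow> 'f \<Rightarrow> 'f::{real_inner,banach}) inner"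
  by unfold_locales
    (auto simp: conjugate_real_def inner_commute power2_norm_eq_inner algebra_simps)

lemma hilbert_space_complex:
  "hilbert_space ((*) :: complex \<Rightarrow> complex \<Rightarrow> complex) (\<lambda>a b. a * cnj b)"
  by unfold_locales
    (auto simp: conjugate_complex_def complex_norm_square scaleR_conv_of_real algebra_simps
      simp del: of_real_power)

definition bounded_operator :: "('k::rc_field \<Rightarrow> 'f::banach \<Rightarrow> 'f) \<Rightarrow> ('f \<Rightarrow> 'f) \<Rightarrow> bool" where
  "bounded_operator smul A \<longleftrightarrow> Vector_Spaces.linear smul smul A \<and> bounded_linear A"

definition adj :: "('f::banach \<Rightarrow> 'f \<Rightarrow> 'k::rc_field) \<Rightarrow> ('f \<Rightarrow> 'f) \<Rightarrow> ('f \<Rightarrow> 'f)" where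
  "adj ip A = (THE B. \<forall>f h. ip (A f) h = ip f (B h))"

definition proj :: "('f::banach \<Rightarrow> 'f \<Rightarrow> 'k::rc_field) \<Rightarrow> 'f set \<Rightarrow> 'f \<Rightarrow> 'f" where
  "proj ip M f = (THE g. g \<in> M \<and> (\<forall>h\<in>M. ip (f - g) h = 0))"

text \<open>
  Strict positivity only, with no positive lower bound. The witness \<open>r\<close> expresses
  \<open>ip (A f) f > 0\<close> for a scalar field without an order.
\<close>

definition positive_operator ::
  "('k::rc_field \<Rightarrow> 'f::banach \<Rightarrow> 'f) \<Rightarrow> ('f \<Rightarrow> 'f \<Rightarrow> 'k) \<Rightarrow> ('f \<Rightarrow> 'f) \<Rightarrow> bool" where
  "positive_operator smul ip A \<longleftrightarrow>
     bounded_operator smul A \<and>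
     (\<forall>f h. ip (A f) h = ip f (A h)) \<and>
     (\<forall>f. f \<noteq> 0 \<longrightarrow> (\<exists>r>0. ip (A f) f = of_real r))"

text \<open>
  The nonnegative square root of a positive operator is itself positive in the strict sense, so
  this description is the usual positive square root.
\<close>

definition op_sqrt ::
  "('k::rc_field \<Rightarrow> 'f::banach \<Rightarrow> 'f) \<Rightarrow> ('f \<Rightarrow> 'f \<Rightarrow> 'k) \<Rightarrow> ('f \<Rightarrow> 'f) \<Rightarrow> ('f \<Rightarrow> 'f)" where
  "op_sqrt smul ip C = (THE S. positive_operator smul ip S \<and> S \<circ> S = C)"

definition strong_conv :: "(real \<Rightarrow> 'f::banach \<Rightarrow> 'f) \<Rightarrow> ('f \<Rightarrow> 'f) \<Rightarrow> bool" where
  "strong_conv A B \<longleftrightarrow> (\<forall>f. ((\<lambda>\<alpha>. A \<alpha> f) \<longlongrightarrow> B f) at_top)"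

definition weak_conv ::
  "('f::banach \<Rightarrow> 'f \<Rightarrow> 'k::rc_field) \<Rightarrow> (real \<Rightarrow> 'f \<Rightarrow> 'f) \<Rightarrow> ('f \<Rightarrow> 'f) \<Rightarrow> bool" where
  "weak_conv ip A B \<longleftrightarrow> (\<forall>f h. ((\<lambda>\<alpha>. ip (A \<alpha> f) h) \<longlongrightarrow> ip (B f) h) at_top)"

definition continuous_bordered_nest ::
  "('k::rc_field \<Rightarrow> 'f::banach \<Rightarrow> 'f) \<Rightarrow> ('f \<Rightarrow> 'f \<Rightarrow> 'k) \<Rightarrow> real \<Rightarrow> (real \<Rightarrow> 'f set) \<Rightarrow> bool" where
  "continuous_bordered_nest smul ip T F \<longleftrightarrow>
     (\<forall>s\<in>{0..T}. module.subspace smul (F s) \<and> closed (F s)) \<and>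
     (\<forall>s\<in>{0..T}. \<forall>s'\<in>{0..T}. s < s' \<longrightarrow> F s \<subseteq> F s') \<and>
     (\<forall>s\<in>{0..T}. \<forall>f. ((\<lambda>s'. proj ip (F s') f) \<longlongrightarrow> proj ip (F s) f) (at s within {0..T})) \<and>
     F 0 = {0} \<and> F T = UNIV"

text \<open>The partition \<open>0 = s 0 < s 1 < \<dots> < s n = T\<close>; only the values of \<open>s\<close> on \<open>{0..n}\<close> matter.\<close>

definition is_partition :: "real \<Rightarrow> nat \<Rightarrow> (nat \<Rightarrow> real) \<Rightarrow> bool" where
  "is_partition T n s \<longleftrightarrow> s 0 = 0 \<and> s n = T \<and> (\<forall>k\<in>{1..n}. s (k - 1) < s k)"

definition partition_range :: "nat \<Rightarrow> (nat \<Rightarrow> real) \<Rightarrow> real" where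
  "partition_range n s = Max ((\<lambda>k. s k - s (k - 1)) ` {1..n})"

definition image_proj ::
  "('f::banach \<Rightarrow> 'f \<Rightarrow> 'k::rc_field) \<Rightarrow> (real \<Rightarrow> 'f set) \<Rightarrow> ('f \<Rightarrow> 'f) \<Rightarrow> real \<Rightarrow> 'f \<Rightarrow> 'f" where
  "image_proj ip F W s = proj ip (closure (W ` F s))"

definition diagonal_sum ::
  "('f::banach \<Rightarrow> 'f \<Rightarrow> 'k::rc_field) \<Rightarrow> (real \<Rightarrow> 'f set) \<Rightarrow> ('f \<Rightarrow> 'f) \<Rightarrow>
     nat \<Rightarrow> (nat \<Rightarrow> real) \<Rightarrow> 'f \<Rightarrow> 'f" where
  "diagonal_sum ip F W n s f =
     (\<Sum>k=1..n. let g = W (proj ip (F (s k)) f - proj ip (F (s (k - 1))) f)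
        in image_proj ip F W (s k) g - image_proj ip F W (s (k - 1)) g)"

definition has_diagonal ::
  "('k::rc_field \<Rightarrow> 'f::banach \<Rightarrow> 'f) \<Rightarrow> ('f \<Rightarrow> 'f \<Rightarrow> 'k) \<Rightarrow> real \<Rightarrow> (real \<Rightarrow> 'f set) \<Rightarrow>
     ('f \<Rightarrow> 'f) \<Rightarrow> ('f \<Rightarrow> 'f) \<Rightarrow> bool" where
  "has_diagonal smul ip T F W D \<longleftrightarrow>
     bounded_operator smul D \<and>
     (\<forall>\<epsilon>>0. \<forall>f h. \<exists>\<delta>>0. \<forall>n s. is_partition T n s \<and> partition_range n s < \<delta> \<longrightarrow>
        norm (ip (D f - diagonal_sum ip F W n s f) h) < \<epsilon>)"

text \<open>Weak limits are unique, so this denotes the diagonal whenever \<open>has_diagonal\<close> has a solution.\<close>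

definition diagonal ::
  "('k::rc_field \<Rightarrow> 'f::banach \<Rightarrow> 'f) \<Rightarrow> ('f \<Rightarrow> 'f \<Rightarrow> 'k) \<Rightarrow> real \<Rightarrow> (real \<Rightarrow> 'f set) \<Rightarrow>
     ('f \<Rightarrow> 'f) \<Rightarrow> ('f \<Rightarrow> 'f)" where
  "diagonal smul ip T F W = (THE D. has_diagonal smul ip T F W D)"

definition canonical_factor ::
  "('k::rc_field \<Rightarrow> 'f::banach \<Rightarrow> 'f) \<Rightarrow> ('f \<Rightarrow> 'f \<Rightarrow> 'k) \<Rightarrow> real \<Rightarrow> (real \<Rightarrow> 'f set) \<Rightarrow>
     ('f \<Rightarrow> 'f) \<Rightarrow> ('f \<Rightarrow> 'f)" where
  "canonical_factor smul ip T F C =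
     adj ip (diagonal smul ip T F (op_sqrt smul ip C)) \<circ> op_sqrt smul ip C"

definition admits_canonical_factorization ::
  "('k::rc_field \<Rightarrow> 'f::banach \<Rightarrow> 'f) \<Rightarrow> ('f \<Rightarrow> 'f \<Rightarrow> 'k) \<Rightarrow> real \<Rightarrow> (real \<Rightarrow> 'f set) \<Rightarrow>
     ('f \<Rightarrow> 'f) \<Rightarrow> bool" where
  "admits_canonical_factorization smul ip T F C \<longleftrightarrow>
     (let D = diagonal smul ip T F (op_sqrt smul ip C);
          V = canonical_factor smul ip T F C
      in (\<exists>D'. has_diagonal smul ip T F (op_sqrt smul ip C) D') \<and>
         D \<circ> adj ip D = id \<and> C = adj ip V \<circ> V)"

definition regular_conv ::
  "('f::banach \<Rightarrow> 'f \<Rightarrow> 'k::rc_field) \<Rightarrow> real \<Rightarrow> (real \<Rightarrow> 'f set) \<Rightarrow>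
     (real \<Rightarrow> 'f \<Rightarrow> 'f) \<Rightarrow> ('f \<Rightarrow> 'f) \<Rightarrow> bool" where
  "regular_conv ip T F Wa W \<longleftrightarrow>
     strong_conv Wa W \<and>
     (\<forall>s\<in>{0..T}. strong_conv (\<lambda>\<alpha>. image_proj ip F (Wa \<alpha>) s) (image_proj ip F W s))"

end

theory Submission
  imports Defs
begin

text \<open>
  Since \<open>D D\<^sup>* = I\<close>, the diagonals are contractions, and
  \<open>(V\<^sup>\<alpha> f, h) = (\<surd>C\<^sup>\<alpha> f, D\<^sup>\<alpha> h)\<close>. As \<open>\<surd>C\<^sup>\<alpha> f\<close> converges in norm, it suffices that
  \<open>D\<^sup>\<alpha> \<rightarrow> D\<close> weakly. Regular convergence gives strong convergence of the sums over a fixed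
  partition, and the uniformity hypothesis allows passing to the diagonals.
\<close>

text \<open>The scalar field carries no order, so positivity arguments run through a real-valued
  form \<open>rip\<close> and return to \<open>ip\<close> by injectivity of \<open>of_real\<close>
  or by a suitable choice of scalar. \<open>proj\<close>, \<open>adj\<close>, \<open>op_sqrt\<close>
  and \<open>diagonal\<close> are definite descriptions, which say nothing until existence and
  uniqueness are known. Hence the projection theorem, Riesz representation, the theory of positive
  roots, and the construction of arbitrarily fine partitions. What the root theory delivers to the
  convergence argument is that the roots of \<open>C\<close> and \<open>Ca \<alpha>\<close> are
  bounded operators. Then the closed image of each nest space is a closed subspace, and the
  projection onto it is a contraction. That contractivity settles the delicate point for a fixed
  partition: in each term both the projection and the vector it acts on move with \<alpha>.\<close>

section \<open>Conjugation in the scalar field\<close>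

lemma conjugate_one [simp]: "conjugate (1::'k::rc_field) = 1"
  using mult_conjugate[of "1::'k"] by simp

lemma conjugate_zero [simp]: "conjugate (0::'k::rc_field) = 0"
  using conjugate_add[of "0::'k" 0] by simp

text \<open>Take norms in \<open>mult_conjugate\<close> and cancel \<open>norm a\<close>. Isometry
  together with additivity makes conjugation continuous.\<close>

lemma norm_conjugate [simp]: "norm (conjugate (a::'k::rc_field)) = norm a"
proof (cases "a = 0")
  case False
  have "norm a * norm (conjugate a) = norm (a * conjugate a)"
    by (simp add: norm_mult)
  also have "\<dots> = (norm a)\<^sup>2"
    by (simp add: mult_conjugate)
  finally show ?thesis
    using False by (simp add: power2_eq_square)
qed simp

lemma conjugate_of_real [simp]: "conjugate (of_real r :: 'k::rc_field) = of_real r"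
proof (cases "r = 0")
  case False
  have "of_real r * conjugate (of_real r :: 'k) = of_real r * of_real r"
    by (simp add: mult_conjugate scaleR_conv_of_real power2_eq_square)
  with False show ?thesis by simp
qed simp

lemma conjugate_minus: "conjugate (- a :: 'k::rc_field) = - conjugate a"
  using conjugate_add[of a "- a"] by (simp add: eq_neg_iff_add_eq_0 add.commute)

lemma conjugate_diff: "conjugate (a - b :: 'k::rc_field) = conjugate a - conjugate b"
  using conjugate_add[of a "- b"] by (simp add: conjugate_minus)

lemma tendsto_conjugate:
  assumes "(f \<longlongrightarrow> (l::'k::rc_field)) G"
  shows "((\<lambda>x. conjugate (f x)) \<longlongrightarrow> conjugate l) G"
  using assms by (simp add: tendsto_iff dist_norm flip: conjugate_diff)

section \<open>The inner product, its real part and Cauchy-Schwarz inequalities\<close>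

context hilbert_space
begin

lemma ip_diff: "ip (f - g) h = ip f h - ip g h"
  by (metis ip_add add_diff_cancel_right' diff_add_cancel)

lemma ip_zero [simp]: "ip 0 h = 0"
  using ip_add[of 0 0 h] by simp

lemma ip_add_right: "ip h (f + g) = ip h f + ip h g"
  by (metis ip_add ip_conjugate conjugate_add)

lemma ip_diff_right: "ip h (f - g) = ip h f - ip h g"
  by (metis ip_diff ip_conjugate conjugate_diff)

lemma ip_zero_right [simp]: "ip h 0 = 0"
  using ip_add_right[of h 0 0] by simp

lemma ip_scale_right: "ip h (smul c f) = conjugate c * ip h f"
  by (metis ip_scale ip_conjugate conjugate_mult)

lemma ip_scaleR: "ip (r *\<^sub>R f) h = of_real r * ip f h"
  by (metis scale_of_real ip_scale)

lemma ip_scaleR_right: "ip h (r *\<^sub>R f) = of_real r * ip h f"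
  by (metis scale_of_real ip_scale_right conjugate_of_real)

lemma smul_scaleR: "smul c (r *\<^sub>R f) = r *\<^sub>R smul c f"
  by (metis scale_of_real scale_left_commute)

text \<open>The locale ties \<open>smul\<close> to the norm only for real scalars; for a general
  scalar, homogeneity is read off from \<open>ip\<close> of the scaled vector with itself.\<close>

lemma norm_smul: "norm (smul c f) = norm c * norm f"
proof -
  have "of_real ((norm (smul c f))\<^sup>2) = (c * conjugate c) * ip f f"
    unfolding ip_self[symmetric] by (simp add: ip_scale ip_scale_right mult_ac)
  also have "\<dots> = (of_real ((norm c * norm f)\<^sup>2) :: 'k)"
    by (simp add: mult_conjugate ip_self scaleR_conv_of_real power_mult_distrib)
  finally have "(norm (smul c f))\<^sup>2 = (norm c * norm f)\<^sup>2"
    using of_real_eq_iff by blast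
  then show ?thesis by simp
qed

lemma bounded_linear_smul: "bounded_linear (smul c)"
  by (rule bounded_linear_intro[of _ "norm c"])
    (simp_all add: scale_right_distrib smul_scaleR norm_smul mult.commute)

text \<open>The real part of \<open>ip\<close>, obtained by polarization since the scalar field has no order.\<close>

definition rip :: "'f \<Rightarrow> 'f \<Rightarrow> real" where
  "rip f g = ((norm (f + g))\<^sup>2 - (norm f)\<^sup>2 - (norm g)\<^sup>2) / 2"

lemma of_real_rip: "of_real (2 * rip f g) = ip f g + ip g f"
proof -
  have "of_real (2 * rip f g) = ip (f + g) (f + g) - ip f f - ip g g"
    by (simp add: rip_def ip_self)
  then show ?thesis
    by (simp add: ip_add ip_add_right)
qed

text \<open>Real identities are checked in the scalar field, where sesquilinearity of
  \<open>ip\<close> is available, and pulled back along the injective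
  \<open>of_real\<close>.\<close>

lemma rip_eqI: "ip f g + ip g f = of_real (2 * r) \<Longrightarrow> rip f g = r"
  unfolding of_real_rip[symmetric] of_real_eq_iff by simp

lemma rip_commute: "rip f g = rip g f"
  by (simp add: rip_def add.commute)

lemma rip_add: "rip (f + g) h = rip f h + rip g h"
proof (rule rip_eqI)
  have "ip (f + g) h + ip h (f + g) = of_real (2 * rip f h) + of_real (2 * rip g h)"
    unfolding of_real_rip by (simp add: ip_add ip_add_right)
  then show "ip (f + g) h + ip h (f + g) = of_real (2 * (rip f h + rip g h))"
    by (simp add: distrib_left)
qed

lemma rip_scaleR: "rip (r *\<^sub>R f) h = r * rip f h"
proof (rule rip_eqI)
  have "ip (r *\<^sub>R f) h + ip h (r *\<^sub>R f) = of_real r * of_real (2 * rip f h)"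
    unfolding of_real_rip by (simp add: ip_scaleR ip_scaleR_right distrib_left)
  then show "ip (r *\<^sub>R f) h + ip h (r *\<^sub>R f) = of_real (2 * (r * rip f h))"
    by (simp add: mult.left_commute)
qed

lemma rip_minus: "rip (- f) h = - rip f h"
  using rip_scaleR[of "-1"] by simp

lemma rip_diff: "rip (f - g) h = rip f h - rip g h"
  using rip_add[of f "- g"] by (simp add: rip_minus)

lemma rip_add_right: "rip h (f + g) = rip h f + rip h g"
  by (simp add: rip_commute[of h] rip_add)

lemma rip_scaleR_right: "rip h (r *\<^sub>R f) = r * rip h f"
  by (simp add: rip_commute[of h] rip_scaleR)

lemma rip_self: "rip f f = (norm f)\<^sup>2"
  by (rule rip_eqI) (simp add: ip_self)

lemma rip_eq_of_real: "ip f g = of_real r \<Longrightarrow> rip f g = r"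
  by (rule rip_eqI) (simp add: ip_conjugate[of g f])

text \<open>The choice \<open>c = ip f g\<close> turns the real part into the squared modulus of
  \<open>ip f g\<close>.\<close>

lemma rip_zero_imp_ip_zero:
  assumes "\<And>c. rip f (smul c g) = 0"
  shows "ip f g = 0"
proof -
  have "conjugate (ip f g) * ip f g + ip f g * conjugate (ip f g) = 0"
    using of_real_rip[of f "smul (ip f g) g"] assms
    by (simp add: ip_scale ip_scale_right ip_conjugate[of g f])
  then have "(of_real (2 * (norm (ip f g))\<^sup>2) :: 'k) = 0"
    using mult_conjugate[of "ip f g"]
    by (simp add: mult.commute[of "conjugate (ip f g)"] scaleR_conv_of_real)
  then have "2 * (norm (ip f g))\<^sup>2 = 0"
    unfolding of_real_eq_0_iff .
  then show ?thesis by simp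
qed

lemma norm_add_sq: "(norm (f + g))\<^sup>2 = (norm f)\<^sup>2 + 2 * rip f g + (norm g)\<^sup>2"
  by (simp add: rip_def field_simps)

lemma norm_diff_sq: "(norm (f - g))\<^sup>2 = (norm f)\<^sup>2 - 2 * rip f g + (norm g)\<^sup>2"
  using norm_add_sq[of f "- g"] by (simp add: rip_minus rip_commute[of f])

text \<open>Discriminant argument for a form that may be degenerate. It serves with the identity for
  the ordinary inequality, and with \<open>C\<close> and its root for operator estimates.\<close>

lemma form_cauchy_schwarz:
  assumes "linear A" and sym: "\<And>f g. rip (A f) g = rip f (A g)"
    and nonneg: "\<And>f. rip (A f) f \<ge> 0"
  shows "(rip (A f) g)\<^sup>2 \<le> rip (A f) f * rip (A g) g"
proof -
  interpret linear A by fact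
  define a b c where "a = rip (A f) f" and "b = rip (A f) g" and "c = rip (A g) g"
  have q: "0 \<le> a + 2 * t * b + t\<^sup>2 * c" for t
  proof -
    have "rip (A g) f = b"
      by (simp add: b_def sym rip_commute[of g])
    then have "rip (A (f + t *\<^sub>R g)) (f + t *\<^sub>R g) = a + 2 * t * b + t\<^sup>2 * c"
      by (simp add: add scale rip_add rip_scaleR rip_add_right rip_scaleR_right
          a_def b_def c_def power2_eq_square algebra_simps)
    with nonneg[of "f + t *\<^sub>R g"] show ?thesis by simp
  qed
  have "b\<^sup>2 \<le> a * c"
  proof (cases "c = 0")
    case True
    have "b = 0"
    proof (rule ccontr)
      assume "b \<noteq> 0"
      \<comment> \<open>With \<open>c = 0\<close> the polynomial is affine in \<open>t\<close>, and
        this \<open>t\<close> gives it the value -1.\<close>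
      with q[of "- (a + 1) / (2 * b)"] True show False by (simp add: field_simps)
    qed
    with True show ?thesis by simp
  next
    case False
    then have "c > 0" using nonneg[of g] by (simp add: c_def)
    \<comment> \<open>The point \<open>- b / c\<close> is the minimizer of the quadratic.\<close>
    have "a + 2 * (- b / c) * b + (- b / c)\<^sup>2 * c = a - b\<^sup>2 / c"
      using False by (simp add: power2_eq_square)
    with q[of "- b / c"] have "b\<^sup>2 / c \<le> a" by simp
    with \<open>c > 0\<close> show ?thesis by (simp add: field_simps)
  qed
  then show ?thesis by (simp add: a_def b_def c_def)
qed

lemma rip_cauchy_schwarz: "\<bar>rip f g\<bar> \<le> norm f * norm g"
proof -
  have "(rip f g)\<^sup>2 \<le> (norm f * norm g)\<^sup>2"
    using form_cauchy_schwarz[of "\<lambda>x. x" f g]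
    by (simp add: rip_self power_mult_distrib linear_iff)
  then show ?thesis
    using abs_le_square_iff[of "rip f g" "norm f * norm g"] by (simp add: abs_mult)
qed

text \<open>Scaling \<open>g\<close> by \<open>ip f g\<close> makes the pairing real, which reduces
  the claim to the bound for \<open>rip\<close>.\<close>

lemma ip_cauchy_schwarz: "norm (ip f g) \<le> norm f * norm g"
proof (cases "ip f g = 0")
  case False
  have "ip f (smul (ip f g) g) = of_real ((norm (ip f g))\<^sup>2)"
    using mult_conjugate[of "ip f g"]
    by (simp add: ip_scale_right mult.commute scaleR_conv_of_real)
  then have "rip f (smul (ip f g) g) = (norm (ip f g))\<^sup>2"
    by (rule rip_eq_of_real)
  then have "(norm (ip f g))\<^sup>2 \<le> norm f * (norm (ip f g) * norm g)"
    using rip_cauchy_schwarz[of f "smul (ip f g) g"] by (simp add: norm_smul)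
  with False show ?thesis
    by (simp add: power2_eq_square mult.left_commute)
qed simp

lemma bounded_bilinear_ip: "bounded_bilinear ip"
proof
  show "\<exists>K. \<forall>a b. norm (ip a b) \<le> norm a * norm b * K"
    using ip_cauchy_schwarz by (intro exI[of _ 1]) simp
qed (simp_all add: ip_add ip_add_right ip_scaleR ip_scaleR_right scaleR_conv_of_real)

lemmas tendsto_ip = bounded_bilinear.tendsto[OF bounded_bilinear_ip]

lemma ip_eq_zeroD: "ip f f = 0 \<Longrightarrow> f = 0"
  by (simp add: ip_self)

lemma bounded_operatorI:
  assumes "\<And>f g. A (f + g) = A f + A g" and "\<And>c f. A (smul c f) = smul c (A f)"
    and "\<And>f. norm (A f) \<le> norm f * K"
  shows "bounded_operator smul A"
  unfolding bounded_operator_def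
proof
  show "Vector_Spaces.linear smul smul A"
    by unfold_locales (use assms in auto)
  show "bounded_linear A"
    by (rule bounded_linear_intro[of _ K]) (use assms in \<open>auto simp flip: scale_of_real\<close>)
qed

lemma bounded_operatorD:
  assumes "bounded_operator smul A"
  shows bounded_operator_add: "A (f + g) = A f + A g"
    and bounded_operator_diff: "A (f - g) = A f - A g"
    and bounded_operator_smul: "A (smul c f) = smul c (A f)"
    and bounded_operator_bounded_linear: "bounded_linear A"
proof -
  from assms interpret Vector_Spaces.linear smul smul A
    by (simp add: bounded_operator_def)
  show "A (f + g) = A f + A g" "A (f - g) = A f - A g" "A (smul c f) = smul c (A f)"
    by (simp_all add: add diff scale)
  show "bounded_linear A"
    using assms by (simp add: bounded_operator_def)
qed

subsection \<open>Projections and adjoints\<close>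

text \<open>A minimizing sequence for the distance to \<open>M\<close> is Cauchy by the
  parallelogram law; completeness gives a nearest point, and minimality forces
  orthogonality.\<close>

lemma proj_exists:
  assumes "subspace M" "closed M"
  shows "\<exists>g\<in>M. \<forall>h\<in>M. ip (f - g) h = 0"
proof -
  define d where "d = Inf ((\<lambda>g. norm (f - g)) ` M)"
  have "0 \<in> M" using assms(1) by (rule subspace_0)
  have d_le: "d \<le> norm (f - g)" if "g \<in> M" for g
    unfolding d_def using that by (intro cINF_lower bdd_belowI2[where m = 0]) auto
  have d0: "0 \<le> d"
    unfolding d_def using \<open>0 \<in> M\<close> by (intro cINF_greatest) auto
  have "\<exists>g\<in>M. norm (f - g) < d + 1 / real (Suc n)" for n
    using cInf_lessD[of "(\<lambda>g. norm (f - g)) ` M" "d + 1 / real (Suc n)"] \<open>0 \<in> M\<close>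
    unfolding d_def by auto
  then obtain g where g: "\<And>n. g n \<in> M" "\<And>n. norm (f - g n) < d + 1 / real (Suc n)"
    by metis
  have lim: "(\<lambda>n. norm (f - g n)) \<longlonglongrightarrow> d"
  proof (rule tendsto_sandwich[where f = "\<lambda>_. d" and h = "\<lambda>n. d + 1 / real (Suc n)"])
    show "(\<lambda>n. d + 1 / real (Suc n)) \<longlonglongrightarrow> d"
      using tendsto_add[OF tendsto_const LIMSEQ_inverse_real_of_nat, of d]
      by (simp add: inverse_eq_divide)
    show "\<forall>\<^sub>F n in sequentially. norm (f - g n) \<le> d + 1 / real (Suc n)"
      using g(2) by (simp add: less_imp_le)
    show "\<forall>\<^sub>F n in sequentially. d \<le> norm (f - g n)"
      using d_le g(1) by simp
  qed (rule tendsto_const)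
  have par: "(norm (g m - g n))\<^sup>2 \<le> 2 * (norm (f - g m))\<^sup>2 + 2 * (norm (f - g n))\<^sup>2 - 4 * d\<^sup>2"
    for m n
  proof -
    define u v where "u = f - g m" and "v = f - g n"
    \<comment> \<open>The midpoint stays in \<open>M\<close>, so it is at distance at least
      \<open>d\<close> from \<open>f\<close>; this bounds \<open>norm (u + v)\<close> below.\<close>
    define w where "w = smul (of_real (1/2)) (g m + g n)"
    have "w \<in> M"
      unfolding w_def using g(1) assms(1) by (intro subspace_scale subspace_add)
    have "u + v = 2 *\<^sub>R (f - w)"
      by (simp only: u_def v_def w_def scale_of_real) (simp add: algebra_simps scaleR_2)
    then have "norm (u + v) = 2 * norm (f - w)" by simp
    then have "4 * d\<^sup>2 \<le> (norm (u + v))\<^sup>2"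
      using power_mono[OF d_le[OF \<open>w \<in> M\<close>] d0, of 2] by (simp add: power_mult_distrib)
    moreover have "(norm (u - v))\<^sup>2 = (norm (g m - g n))\<^sup>2"
      by (simp add: u_def v_def norm_minus_commute)
    ultimately show ?thesis
      using norm_add_sq[of u v] norm_diff_sq[of u v] by (simp add: u_def v_def)
  qed
  have "Cauchy g"
  proof (rule metric_CauchyI)
    fix e :: real assume "e > 0"
    have "(\<lambda>n. (norm (f - g n))\<^sup>2) \<longlonglongrightarrow> d\<^sup>2"
      by (intro tendsto_intros lim)
    \<comment> \<open>The margin \<open>e\<^sup>2 / 4\<close> occurs in \<open>par\<close> twice
      with factor 2, which adds up to \<open>e\<^sup>2\<close>.\<close>
    then have "\<forall>\<^sub>F n in sequentially. (norm (f - g n))\<^sup>2 < d\<^sup>2 + e\<^sup>2 / 4"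
      by (rule order_tendstoD) (use \<open>e > 0\<close> in simp)
    then obtain N where N: "\<And>n. n \<ge> N \<Longrightarrow> (norm (f - g n))\<^sup>2 < d\<^sup>2 + e\<^sup>2 / 4"
      unfolding eventually_sequentially by blast
    have "dist (g m) (g n) < e" if "m \<ge> N" "n \<ge> N" for m n
    proof (rule power2_less_imp_less)
      show "(dist (g m) (g n))\<^sup>2 < e\<^sup>2"
        using par[of m n] N[OF that(1)] N[OF that(2)] unfolding dist_norm by linarith
    qed (use \<open>e > 0\<close> in simp)
    then show "\<exists>N. \<forall>m\<ge>N. \<forall>n\<ge>N. dist (g m) (g n) < e" by blast
  qed
  then obtain l where l: "g \<longlonglongrightarrow> l"
    using Cauchy_convergent convergent_def by blast
  have "l \<in> M"
    using closed_sequentially[OF assms(2) g(1) l] .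
  have "norm (f - l) = d"
    using lim by (rule LIMSEQ_unique[rotated]) (intro tendsto_intros l)
  have rip0: "rip (f - l) h = 0" if "h \<in> M" for h
  proof (rule ccontr)
    assume ne: "rip (f - l) h \<noteq> 0"
    define b where "b = rip (f - l) h"
    \<comment> \<open>A small move from \<open>l\<close> along \<open>h\<close> that would shorten
      the distance; the added 1 keeps the denominator positive even for
      \<open>h = 0\<close>.\<close>
    define t where "t = b / ((norm h)\<^sup>2 + 1)"
    have "l + t *\<^sub>R h \<in> M"
      using \<open>l \<in> M\<close> that assms(1) by (metis scale_of_real subspace_add subspace_scale)
    from power_mono[OF d_le[OF this] d0, of 2]
    have "(norm (f - l))\<^sup>2 \<le> (norm ((f - l) - t *\<^sub>R h))\<^sup>2"
      by (simp add: \<open>norm (f - l) = d\<close> diff_diff_eq)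
    then have "2 * t * b \<le> t\<^sup>2 * (norm h)\<^sup>2"
      unfolding norm_diff_sq[of "f - l"]
      by (simp add: rip_commute[of "f - l"] rip_scaleR power_mult_distrib b_def)
    moreover have tb: "b = t * ((norm h)\<^sup>2 + 1)"
      by (simp add: t_def add_nonneg_eq_0_iff)
    ultimately have "2 * t * (t * ((norm h)\<^sup>2 + 1)) \<le> t\<^sup>2 * (norm h)\<^sup>2"
      by simp
    then have "t\<^sup>2 * ((norm h)\<^sup>2 + 2) \<le> 0"
      by (simp add: power2_eq_square algebra_simps)
    then have "t = 0"
      by (simp add: mult_le_0_iff add_nonneg_eq_0_iff) (smt (verit) zero_le_power2)
    then show False using tb ne by (simp add: b_def)
  qed
  have "ip (f - l) h = 0" if "h \<in> M" for h
    by (rule rip_zero_imp_ip_zero) (use that rip0 assms(1) subspace_scale in blast)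
  with \<open>l \<in> M\<close> show ?thesis by blast
qed

text \<open>Two candidates differ by an element of \<open>M\<close> that is orthogonal to
  itself.\<close>

lemma proj_eqI:
  assumes "subspace M" "g \<in> M" "\<And>h. h \<in> M \<Longrightarrow> ip (f - g) h = 0"
  shows "proj ip M f = g"
  unfolding proj_def
proof (rule the_equality)
  fix g' assume g': "g' \<in> M \<and> (\<forall>h\<in>M. ip (f - g') h = 0)"
  have "g' - g \<in> M"
    using assms g' by (simp add: subspace_diff)
  then have "ip (g' - g) (g' - g) = ip (f - g) (g' - g) - ip (f - g') (g' - g)"
    by (simp flip: ip_diff)
  also have "\<dots> = 0"
    using assms(3) g' \<open>g' - g \<in> M\<close> by simp
  finally show "g' = g"
    using ip_eq_zeroD by fastforce
qed (use assms in auto)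

lemma
  assumes "subspace M" "closed M"
  shows proj_mem: "proj ip M f \<in> M"
    and proj_orthogonal: "h \<in> M \<Longrightarrow> ip (f - proj ip M f) h = 0"
proof -
  obtain g where g: "g \<in> M" "\<And>h. h \<in> M \<Longrightarrow> ip (f - g) h = 0"
    using proj_exists[OF assms] by blast
  with proj_eqI[OF assms(1) g] show "proj ip M f \<in> M"
    "h \<in> M \<Longrightarrow> ip (f - proj ip M f) h = 0" by auto
qed

lemma proj_diff:
  assumes "subspace M" "closed M"
  shows "proj ip M (f - g) = proj ip M f - proj ip M g"
proof (rule proj_eqI)
  fix h assume "h \<in> M"
  then show "ip (f - g - (proj ip M f - proj ip M g)) h = 0"
    using proj_orthogonal[OF assms, of h f] proj_orthogonal[OF assms, of h g]
    by (simp add: ip_diff)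
qed (use assms proj_mem subspace_diff in auto)

lemma norm_proj_le:
  assumes "subspace M" "closed M"
  shows "norm (proj ip M f) \<le> norm f"
proof -
  let ?p = "proj ip M f"
  have "ip (f - ?p) ?p = of_real 0"
    using proj_orthogonal[OF assms proj_mem[OF assms]] by simp
  then have "rip (f - ?p) ?p = 0" by (rule rip_eq_of_real)
  then have "(norm f)\<^sup>2 = (norm (f - ?p))\<^sup>2 + (norm ?p)\<^sup>2"
    using norm_add_sq[of "f - ?p" ?p] by simp
  then have "(norm ?p)\<^sup>2 \<le> (norm f)\<^sup>2" by simp
  then show ?thesis by (rule power2_le_imp_le) simp
qed

text \<open>Riesz representation of the functional sending \<open>f\<close> to
  \<open>ip (A f) h\<close> supplies the value at \<open>h\<close>; uniqueness then lets the
  description in \<open>adj\<close> be unfolded.\<close>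

lemma adj_works:
  assumes "bounded_operator smul A"
  shows "ip (A f) h = ip f (adj ip A h)"
proof -
  note A = bounded_operatorD[OF assms]
  have ex: "\<exists>z. \<forall>f. ip (A f) h = ip f z" for h
  proof (cases "\<forall>f. ip (A f) h = 0")
    case True
    then show ?thesis by (intro exI[of _ 0]) simp
  next
    case False
    then obtain u where u: "ip (A u) h \<noteq> 0" by blast
    define M where "M = {f. ip (A f) h = 0}"
    have "A 0 = 0" using A(2)[of 0 0] by simp
    then have M: "subspace M"
      by (auto simp: M_def A(1,3) ip_add ip_scale intro!: subspaceI)
    have "continuous_on UNIV A"
      using A(4) by (rule linear_continuous_on)
    then have "closed M"
      unfolding M_def
      by (intro closed_Collect_eq continuous_intros bounded_bilinear.continuous_on[OF bounded_bilinear_ip])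
    \<comment> \<open>A vector orthogonal to the kernel \<open>M\<close> on which the functional
      does not vanish.\<close>
    define z where "z = u - proj ip M u"
    have zM: "ip z f = 0" if "f \<in> M" for f
      using that M \<open>closed M\<close> by (simp add: z_def proj_orthogonal)
    have Az: "ip (A z) h = ip (A u) h"
      using proj_mem[OF M \<open>closed M\<close>, of u] by (simp add: z_def M_def A(2) ip_diff)
    with u have "z \<noteq> 0"
      using \<open>A 0 = 0\<close> by auto
    then have zz: "ip z z \<noteq> 0" using ip_eq_zeroD by blast
    \<comment> \<open>Modulo \<open>M\<close> every vector is a multiple of \<open>z\<close>, so
      matching the functional on \<open>z\<close> suffices. The representing vector carries
      \<open>conjugate c\<close> because \<open>ip\<close> is conjugate-linear on the right.\<close>
    define c where "c = ip (A z) h / ip z z"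
    have "ip (A f) h = ip f (smul (conjugate c) z)" for f
    proof -
      define k where "k = ip (A f) h / ip (A z) h"
      have "f - smul k z \<in> M"
        using u by (simp add: M_def A(2,3) ip_diff ip_scale Az k_def)
      then have "ip (f - smul k z) z = 0"
        using zM by (metis ip_conjugate conjugate_zero)
      then have "ip f z = k * ip z z"
        by (simp add: ip_diff ip_scale)
      \<comment> \<open>Involutivity is not an axiom; it follows by comparing
        \<open>mult_conjugate\<close> at \<open>c\<close> and at \<open>conjugate c\<close>, whose
        norms agree.\<close>
      moreover have "conjugate (conjugate c) = c"
      proof (cases "c = 0")
        case False
        have "conjugate c * conjugate (conjugate c) = conjugate c * c"
          by (simp add: mult_conjugate mult.commute[of "conjugate c" c])
        with False show ?thesis
          by (metis mult_cancel_left norm_conjugate norm_eq_zero)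
      qed simp
      ultimately show ?thesis
        using zz u Az by (simp add: ip_scale_right c_def k_def)
    qed
    then show ?thesis by blast
  qed
  have "\<exists>!B. \<forall>f h. ip (A f) h = ip f (B h)"
  proof -
    obtain B where B: "\<forall>f h. ip (A f) h = ip f (B h)"
      using ex by metis
    show ?thesis
    proof (rule ex1I[of _ B], rule B)
      fix B' assume B': "\<forall>f h. ip (A f) h = ip f (B' h)"
      show "B' = B"
      proof
        fix h
        have "ip (B' h - B h) (B' h - B h) = 0"
          using B B' by (simp add: ip_diff_right)
        then show "B' h = B h"
          using ip_eq_zeroD by fastforce
      qed
    qed
  qed
  from theI'[OF this] show ?thesis
    unfolding adj_def by blast
qed

text \<open>The hypothesis makes the adjoint isometric, so pairing \<open>A f\<close> with itself
  and moving one \<open>A\<close> across bounds \<open>norm (A f)\<close> squared by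
  \<open>norm f * norm (A f)\<close>.\<close>

lemma norm_le_of_comp_adj_eq_id:
  assumes "bounded_operator smul A" "A \<circ> adj ip A = id"
  shows "norm (A f) \<le> norm f"
proof -
  have A: "A (adj ip A h) = h" for h
    using assms(2) by (metis comp_apply id_apply)
  have iso: "norm (adj ip A h) = norm h" for h
  proof -
    have "ip (adj ip A h) (adj ip A h) = ip h h"
      by (metis A adj_works assms(1))
    then have "(norm (adj ip A h))\<^sup>2 = (norm h)\<^sup>2"
      unfolding ip_self of_real_eq_iff .
    then show ?thesis by simp
  qed
  have "(norm (A f))\<^sup>2 = norm (ip (A f) (A f))"
    unfolding ip_self norm_of_real by simp
  also have "\<dots> = norm (ip f (adj ip A (A f)))"
    by (metis adj_works assms(1))
  also have "\<dots> \<le> norm f * norm (A f)"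
    using ip_cauchy_schwarz[of f "adj ip A (A f)"] by (simp add: iso)
  finally show ?thesis
    by (cases "A f = 0") (simp_all add: power2_eq_square)
qed

end

subsection \<open>The positive square root\<close>

text \<open>
  The operator iteration below with \<open>X = 1\<close>: its increments dominate those of the operators
  whenever \<open>\<parallel>X\<parallel> \<le> 1\<close>, where no geometric rate of convergence is available.
\<close>

primrec sqrt_majorant :: "nat \<Rightarrow> real" where
  "sqrt_majorant 0 = 0"
| "sqrt_majorant (Suc n) = (1 + (sqrt_majorant n)\<^sup>2) / 2"

lemma sqrt_majorant_bounds: "0 \<le> sqrt_majorant n" "sqrt_majorant n \<le> 1"
  by (induction n) (simp_all add: power_le_one)

lemma incseq_sqrt_majorant: "incseq sqrt_majorant"
proof (rule incseq_SucI)
  fix n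
  have "sqrt_majorant (Suc n) - sqrt_majorant n = (1 - sqrt_majorant n)\<^sup>2 / 2"
    by (simp add: power2_eq_square field_simps)
  then show "sqrt_majorant n \<le> sqrt_majorant (Suc n)"
    using zero_le_power2[of "1 - sqrt_majorant n"] by linarith
qed

lemma Cauchy_sqrt_majorant: "Cauchy sqrt_majorant"
  using incseq_convergent[OF incseq_sqrt_majorant, of 1] sqrt_majorant_bounds
  by (metis convergent_def convergent_Cauchy)

text \<open>
  If \<open>Y\<close> is the limit of this iteration, then \<open>2 Y = X + Y\<^sup>2\<close>, that is, \<open>(I - Y)\<^sup>2 = I - X\<close>.
\<close>

primrec sqrt_iter :: "('f::real_vector \<Rightarrow> 'f) \<Rightarrow> nat \<Rightarrow> 'f \<Rightarrow> 'f" where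
  "sqrt_iter X 0 f = 0"
| "sqrt_iter X (Suc n) f = (1 / 2) *\<^sub>R (X f + sqrt_iter X n (sqrt_iter X n f))"

context hilbert_space
begin

lemma sqrt_iter_linear:
  assumes "bounded_operator smul X"
  shows "sqrt_iter X n (f + g) = sqrt_iter X n f + sqrt_iter X n g"
    and "sqrt_iter X n (smul c f) = smul c (sqrt_iter X n f)"
  by (induction n arbitrary: f g)
    (simp_all add: bounded_operatorD[OF assms] smul_scaleR scale_right_distrib algebra_simps)

lemma sqrt_iter_diff:
  assumes "bounded_operator smul X"
  shows "sqrt_iter X n (f - g) = sqrt_iter X n f - sqrt_iter X n g"
  using sqrt_iter_linear(1)[OF assms, of n "f - g" g] by simp

text \<open>Each iterate is a polynomial in \<open>X\<close>. In the limit this yields the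
  commutation property behind uniqueness of the root.\<close>

lemma sqrt_iter_commute:
  assumes "bounded_operator smul A" "\<And>f. A (X f) = X (A f)"
  shows "A (sqrt_iter X n f) = sqrt_iter X n (A f)"
proof (induction n arbitrary: f)
  case 0
  show ?case using bounded_operator_diff[OF assms(1), of 0 0] by simp
next
  case (Suc n)
  have "A (r *\<^sub>R f) = r *\<^sub>R A f" for r f
    using bounded_operator_smul[OF assms(1)] by (metis scale_of_real)
  then show ?case
    by (simp add: Suc assms(2) bounded_operator_add[OF assms(1)])
qed

lemma sqrt_iter_selfadjoint:
  assumes "\<And>f g. ip (X f) g = ip f (X g)"
  shows "ip (sqrt_iter X n f) g = ip f (sqrt_iter X n g)"
  by (induction n arbitrary: f g)
    (simp_all add: ip_scaleR ip_scaleR_right ip_add ip_add_right assms)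

context
  fixes X
  assumes X: "bounded_operator smul X" and X1: "\<And>f. norm (X f) \<le> norm f"
begin

lemma norm_sqrt_iter_le: "norm (sqrt_iter X n f) \<le> sqrt_majorant n * norm f"
proof (induction n arbitrary: f)
  case (Suc n)
  have "norm (sqrt_iter X n (sqrt_iter X n f)) \<le> sqrt_majorant n * (sqrt_majorant n * norm f)"
    using Suc[of "sqrt_iter X n f"] mult_left_mono[OF Suc[of f] sqrt_majorant_bounds(1)[of n]]
    by linarith
  then show ?case
    using norm_triangle_ineq[of "X f" "sqrt_iter X n (sqrt_iter X n f)"] X1[of f]
    by (simp add: power2_eq_square algebra_simps flip: scaleR_add_right)
qed simp

lemma norm_sqrt_iter_step:
  "norm (sqrt_iter X (Suc n) f - sqrt_iter X n f)
     \<le> (sqrt_majorant (Suc n) - sqrt_majorant n) * norm f"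
proof (induction n arbitrary: f)
  case 0
  then show ?case using X1[of f] by simp
next
  case (Suc n)
  let ?Y = "sqrt_iter X (Suc n)" and ?Z = "sqrt_iter X n"
  let ?y = "sqrt_majorant (Suc n)" and ?z = "sqrt_majorant n"
  have "sqrt_iter X (Suc (Suc n)) f - ?Y f = (1 / 2) *\<^sub>R (?Y (?Y f) - ?Z (?Z f))"
    by (subst (1) sqrt_iter.simps(2), subst (3) sqrt_iter.simps(2)) (simp only: algebra_simps)
  \<comment> \<open>This splitting of a difference of squares needs no commutation; its norm bounds
    recombine as the scalar identity for \<open>?y\<^sup>2 - ?z\<^sup>2\<close>.\<close>
  also have "?Y (?Y f) - ?Z (?Z f) = ?Y (?Y f - ?Z f) + (?Y (?Z f) - ?Z (?Z f))"
    by (simp only: sqrt_iter_diff[OF X]) simp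
  finally have "norm (sqrt_iter X (Suc (Suc n)) f - ?Y f)
      \<le> (norm (?Y (?Y f - ?Z f)) + norm (?Y (?Z f) - ?Z (?Z f))) / 2"
    using norm_triangle_ineq[of "?Y (?Y f - ?Z f)" "?Y (?Z f) - ?Z (?Z f)"]
    by (simp only: norm_scaleR) simp
  also have "norm (?Y (?Y f - ?Z f)) \<le> ?y * ((?y - ?z) * norm f)"
    by (rule order_trans[OF norm_sqrt_iter_le mult_left_mono[OF Suc sqrt_majorant_bounds(1)]])
  also have "norm (?Y (?Z f) - ?Z (?Z f)) \<le> (?y - ?z) * (?z * norm f)"
    by (rule order_trans[OF Suc mult_left_mono[OF norm_sqrt_iter_le]])
      (use incseq_SucD[OF incseq_sqrt_majorant] in \<open>simp del: sqrt_majorant.simps\<close>)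
  also have "(?y * ((?y - ?z) * norm f) + (?y - ?z) * (?z * norm f)) / 2
      = ((1 + ?y\<^sup>2) / 2 - (1 + ?z\<^sup>2) / 2) * norm f"
    by (simp add: power2_eq_square field_simps del: sqrt_majorant.simps)
  also have "\<dots> = (sqrt_majorant (Suc (Suc n)) - ?y) * norm f"
    by simp
  finally show ?case by simp
qed

lemma norm_sqrt_iter_diff:
  "n \<le> m \<Longrightarrow> norm (sqrt_iter X m f - sqrt_iter X n f)
     \<le> (sqrt_majorant m - sqrt_majorant n) * norm f"
proof (induction m rule: dec_induct)
  case (step m)
  show ?case
    using norm_triangle_ineq[of "sqrt_iter X (Suc m) f - sqrt_iter X m f"
        "sqrt_iter X m f - sqrt_iter X n f"] norm_sqrt_iter_step[of m f] step.IH
    by (simp add: left_diff_distrib del: sqrt_majorant.simps sqrt_iter.simps)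
qed simp

lemma convergent_sqrt_iter: "convergent (\<lambda>n. sqrt_iter X n f)"
proof (rule Cauchy_convergent, rule metric_CauchyI)
  fix e :: real assume "e > 0"
  \<comment> \<open>The added 1 covers \<open>f = 0\<close>.\<close>
  then have "e / (norm f + 1) > 0"
    by (simp add: add_nonneg_pos)
  then obtain N where N: "\<And>m n. m \<ge> N \<Longrightarrow> n \<ge> N \<Longrightarrow>
      dist (sqrt_majorant m) (sqrt_majorant n) < e / (norm f + 1)"
    using metric_CauchyD[OF Cauchy_sqrt_majorant] by metis
  have le: "dist (sqrt_iter X m f) (sqrt_iter X n f) < e" if "n \<ge> N" "m \<ge> n" for m n
  proof -
    have "\<bar>sqrt_majorant m - sqrt_majorant n\<bar> * (norm f + 1) < e"
      using N[of m n] that by (simp add: dist_real_def pos_less_divide_eq add_nonneg_pos)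
    moreover have "(sqrt_majorant m - sqrt_majorant n) * norm f
        \<le> \<bar>sqrt_majorant m - sqrt_majorant n\<bar> * (norm f + 1)"
      by (intro mult_mono) auto
    ultimately show ?thesis
      using norm_sqrt_iter_diff[OF that(2), of f] by (simp add: dist_norm)
  qed
  have "dist (sqrt_iter X m f) (sqrt_iter X n f) < e" if "m \<ge> N" "n \<ge> N" for m n
    using le[of n m] le[of m n] that by (cases "n \<le> m") (auto simp: dist_commute)
  then show "\<exists>N. \<forall>m\<ge>N. \<forall>n\<ge>N. dist (sqrt_iter X m f) (sqrt_iter X n f) < e"
    by blast
qed

lemma sqrt_iter_limit:
  assumes sym: "\<And>f g. ip (X f) g = ip f (X g)"
  obtains Y where "bounded_operator smul Y" "\<And>f. norm (Y f) \<le> norm f"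
    "\<And>f g. ip (Y f) g = ip f (Y g)" "\<And>f. 2 *\<^sub>R Y f = X f + Y (Y f)"
    "\<And>A f. bounded_operator smul A \<Longrightarrow> (\<And>f. A (X f) = X (A f)) \<Longrightarrow> A (Y f) = Y (A f)"
proof
  define Y where "Y f = lim (\<lambda>n. sqrt_iter X n f)" for f
  have lim: "(\<lambda>n. sqrt_iter X n f) \<longlonglongrightarrow> Y f" for f
    unfolding Y_def using convergent_sqrt_iter by (simp add: convergent_LIMSEQ_iff)
  have le: "norm (sqrt_iter X n f) \<le> norm f" for n f
    using norm_sqrt_iter_le[of n f] mult_right_mono[OF sqrt_majorant_bounds(2)[of n] norm_ge_zero[of f]]
    by simp
  show Y1: "norm (Y f) \<le> norm f" for f
    by (rule Lim_bounded[OF tendsto_norm[OF lim]]) (use le in auto)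
  have smul_lim: "(\<lambda>n. smul c (g n)) \<longlonglongrightarrow> smul c l" if "g \<longlonglongrightarrow> l" for c g l
    using bounded_linear_smul that by (rule bounded_linear.tendsto)
  show "bounded_operator smul Y"
  proof (rule bounded_operatorI)
    show "Y (f + g) = Y f + Y g" for f g
      using tendsto_add[OF lim lim, of f g] LIMSEQ_unique[OF lim[of "f + g"]]
      by (simp add: sqrt_iter_linear[OF X])
    show "Y (smul c f) = smul c (Y f)" for c f
      using smul_lim[OF lim, of c f] LIMSEQ_unique[OF lim[of "smul c f"]]
      by (simp add: sqrt_iter_linear[OF X])
    show "norm (Y f) \<le> norm f * 1" for f
      using Y1 by simp
  qed
  show "ip (Y f) g = ip f (Y g)" for f g
    using tendsto_ip[OF lim tendsto_const, of f g] tendsto_ip[OF tendsto_const lim, of f g]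
    by (simp add: sqrt_iter_selfadjoint[OF sym]) (blast intro: LIMSEQ_unique)
  show "2 *\<^sub>R Y f = X f + Y (Y f)" for f
  proof -
    \<comment> \<open>Convergence is only pointwise while the inner argument moves with
      \<open>n\<close>; the uniform bound \<open>le\<close> absorbs that motion.\<close>
    have "(\<lambda>n. sqrt_iter X n (sqrt_iter X n f - Y f)) \<longlonglongrightarrow> 0"
    proof (rule Lim_null_comparison)
      show "\<forall>\<^sub>F n in sequentially. norm (sqrt_iter X n (sqrt_iter X n f - Y f))
          \<le> norm (sqrt_iter X n f - Y f)"
        by (simp add: le)
      show "(\<lambda>n. norm (sqrt_iter X n f - Y f)) \<longlonglongrightarrow> 0"
        using lim[of f] by (intro tendsto_norm_zero LIM_zero)
    qed
    from tendsto_add[OF this lim[of "Y f"]]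
    have "(\<lambda>n. sqrt_iter X n (sqrt_iter X n f)) \<longlonglongrightarrow> Y (Y f)"
      by (simp add: sqrt_iter_diff[OF X])
    then have "(\<lambda>n. 2 *\<^sub>R sqrt_iter X (Suc n) f) \<longlonglongrightarrow> X f + Y (Y f)"
      by (simp add: tendsto_add)
    moreover have "(\<lambda>n. 2 *\<^sub>R sqrt_iter X (Suc n) f) \<longlonglongrightarrow> 2 *\<^sub>R Y f"
      using lim[of f] by (intro tendsto_scaleR tendsto_const) (rule LIMSEQ_Suc)
    ultimately show ?thesis
      using LIMSEQ_unique by blast
  qed
  show "A (Y f) = Y (A f)" if A: "bounded_operator smul A" and AX: "\<And>f. A (X f) = X (A f)" for A f
    using bounded_linear.tendsto[OF bounded_operator_bounded_linear[OF A] lim[of f]] lim[of "A f"]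
    by (simp add: sqrt_iter_commute[where A = A and X = X, OF A AX]) (blast intro: LIMSEQ_unique)
qed

end

section \<open>Existence and uniqueness of the positive root\<close>

lemma rip_selfadjoint:
  assumes "\<And>f g. ip (A f) g = ip f (A g)"
  shows "rip (A f) g = rip f (A g)"
  by (rule rip_eqI) (simp only: of_real_rip assms)

lemma
  assumes "positive_operator smul ip A"
  shows positive_operator_bounded: "bounded_operator smul A"
    and positive_operator_selfadjoint: "ip (A f) h = ip f (A h)"
    and positive_operator_rip_selfadjoint: "rip (A f) h = rip f (A h)"
    and positive_operator_rip_pos: "f \<noteq> 0 \<Longrightarrow> rip (A f) f > 0"
    and positive_operator_rip_nonneg: "rip (A f) f \<ge> 0"
    and positive_operator_eq_zeroD: "A f = 0 \<Longrightarrow> f = 0"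
proof -
  show bdd: "bounded_operator smul A" and sym: "ip (A f) h = ip f (A h)" for f h
    using assms by (auto simp: positive_operator_def)
  show "rip (A f) h = rip f (A h)"
    using sym by (rule rip_selfadjoint)
  show pos: "rip (A f) f > 0" if "f \<noteq> 0" for f
    using assms that rip_eq_of_real unfolding positive_operator_def by metis
  have "A 0 = 0"
    using bounded_operator_diff[OF bdd, of 0 0] by simp
  then show "rip (A f) f \<ge> 0"
    using pos[of f] rip_self[of 0] by (cases "f = 0") auto
  show "A f = 0 \<Longrightarrow> f = 0"
    using pos[of f] rip_scaleR[of 0 0] by fastforce
qed

lemma linear_bounded_operator: "bounded_operator smul A \<Longrightarrow> linear A"
  using bounded_operator_bounded_linear bounded_linear.linear by blast

text \<open>Rescaling by a norm bound \<open>K\<close> makes \<open>X = I - C / K\<close> a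
  contraction. The iteration gives \<open>Y\<close> with \<open>(I - Y)\<^sup>2 = C / K\<close>,
  hence the root \<open>sqrt K (I - Y)\<close>. The commutation clause is recorded for the
  uniqueness proof.\<close>

lemma sqrt_exists:
  assumes C: "positive_operator smul ip C"
  shows "\<exists>S. positive_operator smul ip S \<and> S \<circ> S = C \<and>
    (\<forall>A. bounded_operator smul A \<longrightarrow> (\<forall>f. A (C f) = C (A f)) \<longrightarrow> (\<forall>f. A (S f) = S (A f)))"
proof -
  note bC = positive_operator_bounded[OF C]
  obtain K where K: "K > 0" "\<And>f. norm (C f) \<le> norm f * K"
    using bounded_linear.pos_bounded[OF bounded_operator_bounded_linear[OF bC]] by blast
  define X where "X f = f - (1 / K) *\<^sub>R C f" for f
  \<comment> \<open>Cauchy-Schwarz for the form of \<open>C\<close> at \<open>f\<close> and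
    \<open>C f\<close>. This bound lets the cross term in the expansion of
    \<open>(norm (X f))\<^sup>2\<close> dominate the quadratic one.\<close>
  have C_sq: "(norm (C f))\<^sup>2 \<le> K * rip (C f) f" for f
  proof (cases "C f = 0")
    case False
    have "((norm (C f))\<^sup>2)\<^sup>2 \<le> rip (C f) f * rip (C (C f)) (C f)"
      using form_cauchy_schwarz[OF linear_bounded_operator[OF bC], of f "C f"]
        positive_operator_rip_selfadjoint[OF C] positive_operator_rip_nonneg[OF C]
      by (simp add: rip_self)
    also have "\<dots> \<le> rip (C f) f * (K * (norm (C f))\<^sup>2)"
    proof (rule mult_left_mono[OF _ positive_operator_rip_nonneg[OF C]])
      show "rip (C (C f)) (C f) \<le> K * (norm (C f))\<^sup>2"
        using rip_cauchy_schwarz[of "C (C f)" "C f"]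
          mult_right_mono[OF K(2)[of "C f"] norm_ge_zero[of "C f"]]
        by (simp add: power2_eq_square mult_ac)
    qed
    finally have "(norm (C f))\<^sup>2 * (norm (C f))\<^sup>2 \<le> (K * rip (C f) f) * (norm (C f))\<^sup>2"
      by (simp add: power2_eq_square mult_ac)
    then show ?thesis
      by (rule mult_right_le_imp_le) (use False in simp)
  qed (use K(1) positive_operator_rip_nonneg[OF C, of f] in simp)
  have X1: "norm (X f) \<le> norm f" for f
  proof (rule power2_le_imp_le)
    have "(norm (X f))\<^sup>2 = (norm f)\<^sup>2 - 2 * rip (C f) f / K + (norm (C f))\<^sup>2 / K\<^sup>2"
      unfolding X_def norm_diff_sq
      by (simp add: rip_scaleR_right rip_commute[of f] power_divide)
    also have "(norm (C f))\<^sup>2 / K\<^sup>2 \<le> rip (C f) f / K"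
      using divide_right_mono[OF C_sq[of f], of "K\<^sup>2"] K(1) by (simp add: power2_eq_square)
    also have "(norm f)\<^sup>2 - 2 * rip (C f) f / K + rip (C f) f / K \<le> (norm f)\<^sup>2"
      using K(1) positive_operator_rip_nonneg[OF C, of f] by (simp add: field_simps)
    finally show "(norm (X f))\<^sup>2 \<le> (norm f)\<^sup>2" by simp
  qed simp
  have X: "bounded_operator smul X"
  proof (rule bounded_operatorI)
    show "norm (X f) \<le> norm f * 1" for f using X1 by simp
  qed (simp_all add: X_def bounded_operatorD[OF bC] smul_scaleR scale_right_diff_distrib
      algebra_simps)
  have "ip (X f) g = ip f (X g)" for f g
    by (simp add: X_def ip_diff ip_diff_right ip_scaleR ip_scaleR_right
        positive_operator_selfadjoint[OF C])
  from sqrt_iter_limit[OF X X1 this]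
  obtain Y where Y: "bounded_operator smul Y" "\<And>f. norm (Y f) \<le> norm f"
    and Y_sym: "\<And>f g. ip (Y f) g = ip f (Y g)" and YY: "\<And>f. 2 *\<^sub>R Y f = X f + Y (Y f)"
    and Y_comm: "\<And>A f. bounded_operator smul A \<Longrightarrow> (\<And>f. A (X f) = X (A f)) \<Longrightarrow> A (Y f) = Y (A f)"
    by blast
  define S where "S f = sqrt K *\<^sub>R (f - Y f)" for f
  have Y_scaleR: "Y (r *\<^sub>R f) = r *\<^sub>R Y f" for r f
    using bounded_operator_smul[OF Y(1)] by (metis scale_of_real)
  have SS: "S (S f) = C f" for f
  proof -
    have "S (S f) = (sqrt K * sqrt K) *\<^sub>R (f - 2 *\<^sub>R Y f + Y (Y f))"
      by (simp add: S_def Y_scaleR bounded_operator_diff[OF Y(1)] algebra_simps scaleR_2)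
    also have "\<dots> = K *\<^sub>R (f - X f)"
      using K(1) by (simp add: YY)
    also have "\<dots> = C f"
      using K(1) by (simp add: X_def)
    finally show ?thesis .
  qed
  have S_bdd: "bounded_operator smul S"
  proof (rule bounded_operatorI)
    show "norm (S f) \<le> norm f * (sqrt K * 2)" for f
    proof -
      have "norm (f - Y f) \<le> 2 * norm f"
        using norm_triangle_ineq4[of f "Y f"] Y(2)[of f] by simp
      then show ?thesis
        using K(1) by (simp add: S_def mult.commute)
    qed
  qed (simp_all add: S_def bounded_operatorD[OF Y(1)] smul_scaleR scale_right_diff_distrib
      algebra_simps)
  have S_sym: "ip (S f) g = ip f (S g)" for f g
    by (simp add: S_def ip_diff ip_diff_right ip_scaleR ip_scaleR_right Y_sym)
  have S_ip: "ip (S f) f = of_real (rip (S f) f)" for f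
    using of_real_rip[of "S f" f] S_sym[of f f] by simp
  have S_nonneg: "rip (S f) f \<ge> 0" for f
  proof -
    have "rip (Y f) f \<le> norm f * norm f"
      using rip_cauchy_schwarz[of "Y f" f] mult_right_mono[OF Y(2)[of f] norm_ge_zero[of f]]
      by linarith
    then show ?thesis
      using K(1) by (simp add: S_def rip_scaleR rip_diff rip_self power2_eq_square)
  qed
  \<comment> \<open>Strictness is inherited from \<open>C\<close>: a vanishing form forces
    \<open>S f = 0\<close> by Cauchy-Schwarz, hence \<open>C f = 0\<close>.\<close>
  have S_pos: "rip (S f) f > 0" if "f \<noteq> 0" for f
  proof (rule ccontr)
    assume "\<not> rip (S f) f > 0"
    then have "rip (S f) f = 0" using S_nonneg[of f] by simp
    moreover have "rip (S f) g = rip f (S g)" for f g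
      using S_sym by (rule rip_selfadjoint)
    ultimately have "(rip (S f) (S f))\<^sup>2 \<le> 0"
      using form_cauchy_schwarz[OF linear_bounded_operator[OF S_bdd], of f "S f"] S_nonneg by simp
    then have "S f = 0" by (simp add: rip_self)
    then have "C f = 0"
      using SS[of f] bounded_operator_diff[OF S_bdd, of 0 0] by simp
    with positive_operator_eq_zeroD[OF C] that show False by blast
  qed
  have "A (S f) = S (A f)" if A: "bounded_operator smul A" and AC: "\<And>f. A (C f) = C (A f)" for A f
  proof -
    have A_scaleR: "A (r *\<^sub>R f) = r *\<^sub>R A f" for r f
      using bounded_operator_smul[OF A] by (metis scale_of_real)
    have "A (X f) = X (A f)" for f
      by (simp add: X_def bounded_operator_diff[OF A] A_scaleR AC)
    from Y_comm[OF A this] show ?thesis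
      by (simp add: S_def A_scaleR bounded_operator_diff[OF A])
  qed
  moreover have "positive_operator smul ip S"
    unfolding positive_operator_def using S_bdd S_sym S_pos S_ip by blast
  ultimately show ?thesis
    using SS by (intro exI[of _ S]) auto
qed

text \<open>Any other root \<open>R\<close> commutes with \<open>C = R \<circ> R\<close>, hence with
  \<open>S\<close>, and two commuting positive roots must coincide.\<close>

lemma positive_op_sqrt:
  assumes C: "positive_operator smul ip C"
  shows "positive_operator smul ip (op_sqrt smul ip C)"
proof -
  obtain S where S: "positive_operator smul ip S" "S \<circ> S = C"
    and comm: "\<And>A f. bounded_operator smul A \<Longrightarrow> \<forall>f. A (C f) = C (A f) \<Longrightarrow> A (S f) = S (A f)"
    using sqrt_exists[OF C] by blast
  have "op_sqrt smul ip C = S"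
    unfolding op_sqrt_def
  proof (rule the_equality)
    fix R assume "positive_operator smul ip R \<and> R \<circ> R = C"
    then have R: "positive_operator smul ip R" "R \<circ> R = C" by auto
    note bR = positive_operator_bounded[OF R(1)] and bS = positive_operator_bounded[OF S(1)]
    have sq: "R (R f) = C f" "S (S f) = C f" for f
      using R(2) S(2) by (metis comp_apply)+
    have RS: "R (S f) = S (R f)" for f
      using comm[OF bR] by (metis sq(1))
    show "R = S"
    proof
      fix f
      let ?g = "R f - S f"
      \<comment> \<open>By commutation this is \<open>R\<^sup>2 f - S\<^sup>2 f\<close>. Pairing
        with \<open>?g\<close> gives a sum of two terms, both strictly positive unless
        \<open>?g = 0\<close>.\<close>
      have "R ?g + S ?g = 0"
        by (simp add: bounded_operator_diff[OF bR] bounded_operator_diff[OF bS] sq RS)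
      then have "rip (R ?g) ?g + rip (S ?g) ?g = 0"
        using rip_scaleR[of 0 0 ?g] by (simp flip: rip_add)
      then have "?g = 0"
        using positive_operator_rip_pos[OF R(1), of ?g] positive_operator_rip_pos[OF S(1), of ?g]
        by fastforce
      then show "R f = S f" by simp
    qed
  qed (use S in simp)
  with S show ?thesis by simp
qed

subsection \<open>Diagonals and canonical factors\<close>

lemma subspace_closure_image:
  assumes A: "bounded_operator smul A" and M: "subspace M"
  shows "subspace (closure (A ` M))"
proof (rule subspaceI)
  have "A 0 = 0"
    using bounded_operator_diff[OF A, of 0 0] by simp
  then show "0 \<in> closure (A ` M)"
    using M closure_subset subspace_0 by (metis image_eqI subsetD)
next
  fix x y assume "x \<in> closure (A ` M)" "y \<in> closure (A ` M)"
  then obtain u v where uv: "\<And>n. u n \<in> A ` M" "u \<longlonglongrightarrow> x" "\<And>n. v n \<in> A ` M" "v \<longlonglongrightarrow> y"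
    unfolding closure_sequential by blast
  have "u n + v n \<in> A ` M" for n
    using uv(1,3)[of n] subspace_add[OF M]
    by (auto simp flip: bounded_operator_add[OF A])
  then show "x + y \<in> closure (A ` M)"
    unfolding closure_sequential using tendsto_add[OF uv(2,4)]
    by (intro exI[of _ "\<lambda>n. u n + v n"]) simp
next
  fix c x assume "x \<in> closure (A ` M)"
  then obtain u where u: "\<And>n. u n \<in> A ` M" "u \<longlonglongrightarrow> x"
    unfolding closure_sequential by blast
  have "smul c (u n) \<in> A ` M" for n
    using u(1)[of n] subspace_scale[OF M]
    by (auto simp flip: bounded_operator_smul[OF A])
  then show "smul c x \<in> closure (A ` M)"
    unfolding closure_sequential using bounded_linear.tendsto[OF bounded_linear_smul u(2)]
    by (intro exI[of _ "\<lambda>n. smul c (u n)"]) simp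
qed

text \<open>Since the projections are contractions, replacing the moving vector
  \<open>Wa \<alpha> x\<close> by its limit \<open>y\<close> costs at most
  \<open>norm (Wa \<alpha> x - y)\<close>.\<close>

lemma image_proj_tendsto:
  assumes M: "subspace (F s)" and Wa: "\<forall>\<^sub>F \<alpha> in G. bounded_operator smul (Wa \<alpha>)"
    and W: "((\<lambda>\<alpha>. Wa \<alpha> x) \<longlongrightarrow> y) G"
    and P: "((\<lambda>\<alpha>. image_proj ip F (Wa \<alpha>) s y) \<longlongrightarrow> z) G"
  shows "((\<lambda>\<alpha>. image_proj ip F (Wa \<alpha>) s (Wa \<alpha> x)) \<longlongrightarrow> z) G"
proof -
  have "((\<lambda>\<alpha>. image_proj ip F (Wa \<alpha>) s (Wa \<alpha> x) - image_proj ip F (Wa \<alpha>) s y) \<longlongrightarrow> 0) G"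
  proof (rule Lim_null_comparison)
    show "\<forall>\<^sub>F \<alpha> in G. norm (image_proj ip F (Wa \<alpha>) s (Wa \<alpha> x) - image_proj ip F (Wa \<alpha>) s y)
        \<le> norm (Wa \<alpha> x - y)"
      using Wa
    proof eventually_elim
      case (elim \<alpha>)
      note sub = subspace_closure_image[OF elim M] closed_closure
      show ?case
        unfolding image_proj_def using norm_proj_le[OF sub] by (simp flip: proj_diff[OF sub])
    qed
    show "((\<lambda>\<alpha>. norm (Wa \<alpha> x - y)) \<longlongrightarrow> 0) G"
      using W by (intro tendsto_norm_zero LIM_zero)
  qed
  from tendsto_add[OF this P] show ?thesis by simp
qed

text \<open>For a fixed partition the sum is finite and the increments of the nest projections at
  \<open>f\<close> do not depend on \<alpha>, so each term converges by regularity.\<close>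

lemma diagonal_sum_tendsto:
  assumes nest: "continuous_bordered_nest smul ip T F" and part: "is_partition T n s"
    and pos: "\<And>\<alpha>. \<alpha> > 0 \<Longrightarrow> bounded_operator smul (Wa \<alpha>)"
    and conv: "regular_conv ip T F Wa W"
  shows "((\<lambda>\<alpha>. diagonal_sum ip F (Wa \<alpha>) n s f) \<longlongrightarrow> diagonal_sum ip F W n s f) at_top"
proof -
  have mono: "s i \<le> s j" if "i \<le> j" "j \<le> n" for i j
    using that
  proof (induction j rule: dec_induct)
    case (step j)
    have "s j < s (Suc j)"
      using part step.prems by (auto simp: is_partition_def dest: bspec[of _ _ "Suc j"])
    with step show ?case by simp
  qed simp
  \<comment> \<open>The nest conditions and regular convergence speak only of parameters in
    \<open>{0..T}\<close>.\<close>
  have s: "s k \<in> {0..T}" if "k \<le> n" for k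
    using mono[of 0 k] mono[of k n] that part by (simp add: is_partition_def)
  have ev: "\<forall>\<^sub>F \<alpha> in at_top. bounded_operator smul (Wa \<alpha>)"
    using eventually_gt_at_top[of 0] by eventually_elim (rule pos)
  have "((\<lambda>\<alpha>. image_proj ip F (Wa \<alpha>) (s k) (Wa \<alpha> x)) \<longlongrightarrow> image_proj ip F W (s k) (W x)) at_top"
    if "k \<le> n" for k x
  proof (rule image_proj_tendsto[OF _ ev])
    show "subspace (F (s k))"
      using nest s[OF that] by (simp add: continuous_bordered_nest_def)
  qed (use conv s[OF that] in \<open>auto simp: regular_conv_def strong_conv_def\<close>)
  then show ?thesis
    unfolding diagonal_sum_def Let_def by (intro tendsto_sum tendsto_diff) auto
qed

end

text \<open>Equal subdivision into more than \<open>T / \<delta>\<close> pieces. Without such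
  partitions the limit defining a diagonal would be vacuous and determine nothing.\<close>

lemma fine_partition_exists:
  assumes "0 < T" "0 < \<delta>"
  obtains n s where "is_partition T n s" "partition_range n s < \<delta>"
proof -
  obtain m where m: "T / \<delta> < real m"
    using reals_Archimedean2 by blast
  have "0 < T / \<delta>" using assms by simp
  with m have m0: "0 < real m" by linarith
  define s where "s k = real k * T / real m" for k
  have step: "s k - s (k - 1) = T / real m" if "k \<in> {1..m}" for k
    using that by (cases k) (auto simp: s_def field_simps)
  have "T / real m < \<delta>"
    using m m0 assms by (simp add: field_simps)
  moreover have "partition_range m s = T / real m"
  proof -
    have "(\<lambda>k. s k - s (k - 1)) ` {1..m} = {T / real m}"
      using step m0 by (force simp: image_iff)
    then show ?thesis by (simp add: partition_range_def)
  qed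
  moreover have "is_partition T m s"
    unfolding is_partition_def
  proof (intro conjI ballI)
    fix k assume "k \<in> {1..m}"
    have "0 < T / real m" using assms m0 by simp
    with step[OF \<open>k \<in> {1..m}\<close>] show "s (k - 1) < s k" by linarith
  qed (use m0 in \<open>simp_all add: s_def\<close>)
  ultimately show ?thesis using that by simp
qed

context hilbert_space
begin

lemma has_diagonalD:
  assumes "has_diagonal smul ip T F W D" "\<epsilon> > 0"
  shows "\<exists>\<delta>>0. \<forall>n s. is_partition T n s \<longrightarrow> partition_range n s < \<delta> \<longrightarrow>
    norm (ip (D f - diagonal_sum ip F W n s f) h) < \<epsilon>"
  using assms unfolding has_diagonal_def by blast

text \<open>Tested against \<open>D f - D' f\<close> itself, one partition fine enough for both
  limits makes the squared norm of the difference smaller than itself.\<close>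

lemma has_diagonal_unique:
  assumes "0 < T" "has_diagonal smul ip T F W D" "has_diagonal smul ip T F W D'"
  shows "D = D'"
proof
  fix f
  let ?h = "D f - D' f"
  show "D f = D' f"
  proof (rule ccontr)
    assume "D f \<noteq> D' f"
    then have e: "norm (ip ?h ?h) / 2 > 0"
      using ip_eq_zeroD[of ?h] by auto
    obtain \<delta> where d: "\<delta> > 0" "\<And>n s. is_partition T n s \<Longrightarrow> partition_range n s < \<delta> \<Longrightarrow>
        norm (ip (D f - diagonal_sum ip F W n s f) ?h) < norm (ip ?h ?h) / 2"
      using has_diagonalD[OF assms(2) e, of f ?h] by blast
    obtain \<delta>' where d': "\<delta>' > 0" "\<And>n s. is_partition T n s \<Longrightarrow> partition_range n s < \<delta>' \<Longrightarrow>
        norm (ip (D' f - diagonal_sum ip F W n s f) ?h) < norm (ip ?h ?h) / 2"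
      using has_diagonalD[OF assms(3) e, of f ?h] by blast
    have "min \<delta> \<delta>' > 0" using d(1) d'(1) by simp
    from fine_partition_exists[OF \<open>0 < T\<close> this]
    obtain n s where part: "is_partition T n s" "partition_range n s < min \<delta> \<delta>'" .
    have "norm (ip (D f - diagonal_sum ip F W n s f) ?h - ip (D' f - diagonal_sum ip F W n s f) ?h)
        < norm (ip ?h ?h)"
      using d(2)[OF part(1)] d'(2)[OF part(1)] part(2)
        norm_triangle_ineq4[of "ip (D f - diagonal_sum ip F W n s f) ?h"
          "ip (D' f - diagonal_sum ip F W n s f) ?h"] by linarith
    then show False
      unfolding ip_diff[symmetric] by simp
  qed
qed

lemma bounded_operator_diagonal:
  assumes "0 < T" "has_diagonal smul ip T F W D"
  shows "bounded_operator smul (diagonal smul ip T F W)"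
proof -
  have "diagonal smul ip T F W = D"
    unfolding diagonal_def using assms has_diagonal_unique by blast
  then show ?thesis
    using assms(2) by (simp add: has_diagonal_def)
qed

text \<open>Moving the adjoint across the pairing leaves the diagonal itself, for which the
  approximating sums are available. Conjugation is used because \<open>adj_works\<close> places the
  adjoint in the second slot.\<close>

lemma ip_canonical_factor:
  assumes "0 < T" "admits_canonical_factorization smul ip T F C"
  defines "S \<equiv> op_sqrt smul ip C" and "D \<equiv> diagonal smul ip T F (op_sqrt smul ip C)"
  shows "ip (canonical_factor smul ip T F C f) h = ip (S f) (D h)"
    and "norm (D h) \<le> norm h"
proof -
  have "\<exists>D'. has_diagonal smul ip T F S D'" and D_adj: "D \<circ> adj ip D = id"
    using assms(2) unfolding admits_canonical_factorization_def Let_def S_def D_def by blast+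
  then have D: "bounded_operator smul D"
    unfolding D_def S_def using bounded_operator_diagonal[OF assms(1)] by blast
  show "norm (D h) \<le> norm h"
    using D D_adj by (rule norm_le_of_comp_adj_eq_id)
  have "ip h (adj ip D (S f)) = ip (D h) (S f)"
    using adj_works[OF D] by simp
  then show "ip (canonical_factor smul ip T F C f) h = ip (S f) (D h)"
    unfolding canonical_factor_def S_def D_def comp_apply
    by (subst (1 2) ip_conjugate) (simp only:)
qed

end

theorem theorem1:
  fixes smul :: "'k::rc_field \<Rightarrow> 'f::banach \<Rightarrow> 'f"
    and ip :: "'f \<Rightarrow> 'f \<Rightarrow> 'k"
    and T :: real
    and F :: "real \<Rightarrow> 'f set"
    and C :: "'f \<Rightarrow> 'f"
    and Ca :: "real \<Rightarrow> 'f \<Rightarrow> 'f"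
  assumes "hilbert_space smul ip"
    and "0 < T"
    and "continuous_bordered_nest smul ip T F"
    and "positive_operator smul ip C"
    and "\<And>\<alpha>. \<alpha> > 0 \<Longrightarrow> positive_operator smul ip (Ca \<alpha>)"
    and "strong_conv Ca C"
    and "admits_canonical_factorization smul ip T F C"
    and "\<And>\<alpha>. \<alpha> > 0 \<Longrightarrow> admits_canonical_factorization smul ip T F (Ca \<alpha>)"
    and "regular_conv ip T F (\<lambda>\<alpha>. op_sqrt smul ip (Ca \<alpha>)) (op_sqrt smul ip C)"
    and "\<And>\<epsilon> f h. \<epsilon> > 0 \<Longrightarrow>
      \<exists>\<delta>>0. \<forall>n s. is_partition T n s \<and> partition_range n s < \<delta> \<longrightarrow> (\<forall>\<alpha>>0.
        norm (ip (diagonal smul ip T F (op_sqrt smul ip C) f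
                  - diagonal_sum ip F (op_sqrt smul ip C) n s f) h) < \<epsilon> \<and>
        norm (ip (diagonal smul ip T F (op_sqrt smul ip (Ca \<alpha>)) f
                  - diagonal_sum ip F (op_sqrt smul ip (Ca \<alpha>)) n s f) h) < \<epsilon>)"
  shows "weak_conv ip (\<lambda>\<alpha>. canonical_factor smul ip T F (Ca \<alpha>)) (canonical_factor smul ip T F C)"
proof -
  interpret hilbert_space smul ip by fact
  let ?S = "op_sqrt smul ip C" and ?Sa = "\<lambda>\<alpha>. op_sqrt smul ip (Ca \<alpha>)"
  let ?D = "diagonal smul ip T F ?S" and ?Da = "\<lambda>\<alpha>. diagonal smul ip T F (?Sa \<alpha>)"
  have pos: "\<forall>\<^sub>F \<alpha>::real in at_top. 0 < \<alpha>"
    by (rule eventually_gt_at_top)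
  have S_lim: "((\<lambda>\<alpha>. ?Sa \<alpha> f) \<longlongrightarrow> ?S f) at_top" for f
    using assms(9) by (simp add: regular_conv_def strong_conv_def)
  have sum_lim: "((\<lambda>\<alpha>. diagonal_sum ip F (?Sa \<alpha>) n s f) \<longlongrightarrow> diagonal_sum ip F ?S n s f) at_top"
    if "is_partition T n s" for n s f
    using assms(3) that _ assms(9)
    by (rule diagonal_sum_tendsto) (rule positive_operator_bounded[OF positive_op_sqrt[OF assms(5)]])
  have D_lim: "((\<lambda>\<alpha>. ip (?Da \<alpha> f) h) \<longlongrightarrow> ip (?D f) h) at_top" for f h
  proof (rule tendstoI)
    fix e :: real assume "e > 0"
    then obtain \<delta> where "\<delta> > 0" and \<delta>: "\<And>n s \<alpha>. is_partition T n s \<Longrightarrow> partition_range n s < \<delta> \<Longrightarrow> \<alpha> > 0 \<Longrightarrow>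
        norm (ip (?D f - diagonal_sum ip F ?S n s f) h) < e / 3 \<and>
        norm (ip (?Da \<alpha> f - diagonal_sum ip F (?Sa \<alpha>) n s f) h) < e / 3"
      using assms(10)[of "e / 3" f h] by auto
    \<comment> \<open>Uniformity lets one partition be fixed before \<alpha>; only the middle of the
      three \<open>e / 3\<close> errors then requires \<alpha> to be large.\<close>
    obtain n s where part: "is_partition T n s" "partition_range n s < \<delta>"
      using fine_partition_exists[OF \<open>0 < T\<close> \<open>\<delta> > 0\<close>] .
    have "\<forall>\<^sub>F \<alpha> in at_top. dist (ip (diagonal_sum ip F (?Sa \<alpha>) n s f) h)
        (ip (diagonal_sum ip F ?S n s f) h) < e / 3"
      using tendsto_ip[OF sum_lim[OF part(1), of f] tendsto_const, of h] \<open>e > 0\<close>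
      by (intro tendstoD) auto
    with pos show "\<forall>\<^sub>F \<alpha> in at_top. dist (ip (?Da \<alpha> f) h) (ip (?D f) h) < e"
    proof eventually_elim
      case (elim \<alpha>)
      let ?d = "ip (?D f) h" and ?da = "ip (?Da \<alpha> f) h"
      let ?s = "ip (diagonal_sum ip F ?S n s f) h"
      let ?sa = "ip (diagonal_sum ip F (?Sa \<alpha>) n s f) h"
      have "norm (?d - ?s) < e / 3" "norm (?da - ?sa) < e / 3"
        using \<delta>[OF part elim(1)] by (simp_all add: ip_diff)
      then have "dist ?da ?sa < e / 3" "dist ?s ?d < e / 3"
        by (simp_all add: dist_norm norm_minus_commute)
      with elim(2) dist_triangle[of ?da ?d ?sa] dist_triangle[of ?sa ?d ?s] show ?case
        by linarith
    qed
  qed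
  have "((\<lambda>\<alpha>. ip (canonical_factor smul ip T F (Ca \<alpha>) f) h)
      \<longlongrightarrow> ip (canonical_factor smul ip T F C f) h) at_top" for f h
  proof -
    \<comment> \<open>Both slots of the pairing move. Subtracting the fixed vector
      \<open>?S f\<close> leaves a norm-null factor against the bounded
      \<open>?Da \<alpha> h\<close>, plus a pairing covered by weak convergence.\<close>
    have "((\<lambda>\<alpha>. ip (?Sa \<alpha> f - ?S f) (?Da \<alpha> h)) \<longlongrightarrow> 0) at_top"
    proof (rule Lim_null_comparison)
      show "\<forall>\<^sub>F \<alpha> in at_top. norm (ip (?Sa \<alpha> f - ?S f) (?Da \<alpha> h)) \<le> norm (?Sa \<alpha> f - ?S f) * norm h"
        using pos
      proof eventually_elim
        case (elim \<alpha>)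
        show ?case
          by (rule order_trans[OF ip_cauchy_schwarz mult_left_mono])
            (use ip_canonical_factor(2)[OF assms(2) assms(8)[OF elim]] in auto)
      qed
      show "((\<lambda>\<alpha>. norm (?Sa \<alpha> f - ?S f) * norm h) \<longlongrightarrow> 0) at_top"
        by (intro tendsto_mult_left_zero tendsto_norm_zero LIM_zero S_lim)
    qed
    \<comment> \<open>\<open>D_lim\<close> has the diagonal in the first slot; continuity of
      conjugation transfers it to the second.\<close>
    moreover have "((\<lambda>\<alpha>. ip (?S f) (?Da \<alpha> h)) \<longlongrightarrow> ip (?S f) (?D h)) at_top"
      using tendsto_conjugate[OF D_lim[of h "?S f"]] by (simp flip: ip_conjugate)
    ultimately have "((\<lambda>\<alpha>. ip (?Sa \<alpha> f - ?S f) (?Da \<alpha> h) + ip (?S f) (?Da \<alpha> h))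
        \<longlongrightarrow> 0 + ip (?S f) (?D h)) at_top"
      by (rule tendsto_add)
    then have lim: "((\<lambda>\<alpha>. ip (?Sa \<alpha> f) (?Da \<alpha> h)) \<longlongrightarrow> ip (?S f) (?D h)) at_top"
      by (simp add: ip_diff)
    have "\<forall>\<^sub>F \<alpha> in at_top.
        ip (?Sa \<alpha> f) (?Da \<alpha> h) = ip (canonical_factor smul ip T F (Ca \<alpha>) f) h"
      using pos
    proof eventually_elim
      case (elim \<alpha>)
      show ?case
        by (rule ip_canonical_factor(1)[OF assms(2) assms(8)[OF elim], symmetric])
    qed
    from Lim_transform_eventually[OF lim this] show ?thesis
      by (simp only: ip_canonical_factor(1)[OF assms(2,7)])
  qed
  then show ?thesis
    unfolding weak_conv_def by blast
qed

end
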